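(* Let $n \geq 2$ and $1 \leq i \leq n$. Then there is no nontrivial point derivation at $\varphi_{i,0}: \mathcal{T}^{+}(\mathcal{C}_n) \rightarrow \mathbb{C}$; that is, every point derivation $D : \mathcal{T}^{+}(\mathcal{C}_n) \to \mathbb{C}$ at $\varphi_{i,0}$ is identically zero.
   Context: $A(\mathbb{D})$ is the disk algebra: functions holomorphic on the open unit disk $\mathbb{D}$ and continuous on $\overline{\mathbb{D}}$, with the supremum norm. For $1 \leq i,j \leq n$ let $\ell(i,j) \in \{0,1,\dots,n-1\}$ be the residue of $j-i$ modulo $n$. The algebra $\mathcal{T}^{+}(\mathcal{C}_n)$ is the subalgebra of $M_n \otimes A(\mathbb{D}) = M_n(A(\mathbb{D}))$ consisting of all matrices $[z^{\ell(i,j)} f_{i,j}(z^n)]_{i,j=1}^n$ with $f_{i,j} \in A(\mathbb{D})$ for all $i,j$, with the norm inherited from $M_n \otimes A(\mathbb{D})$ (the supremum over $z \in \overline{\mathbb{D}}$ of the operator norm of the matrix at $z$). For $1 \leq i \leq n$ the representation $\varphi_{i,0}: \mathcal{T}^{+}(\mathcal{C}_n) \to \mathbb{C}$ is defined by $\varphi_{i,0}([z^{\ell(i,j)} f_{i,j}(z^n)]) = f_{i,i}(0)$. For a representation $\pi: A \to B(\mathcal{H})$ of an operator algebra $A$ (a continuous representation by operators on a Hilbert space $\mathcal{H}$), a point derivation at $\pi$ is a continuous linear map $D: A \to B(\mathcal{H})$ with $D(ab) = D(a)\pi(b) + \pi(a)D(b)$ for all $a,b \in A$. Here $\mathcal{H}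 = \mathbb{C}$ and $B(\mathcal{H}) = \mathbb{C}$. *)

theory Defs
  imports "HOL-Analysis.Analysis" "Jordan_Normal_Form.Matrix"
begin

no_notation Finite_Cartesian_Product.vec_nth (infixl \<open>$\<close> 90)

text \<open>
  A function on the closed unit disk is represented by its extension by zero to the whole
  plane, so that equality of HOL functions is equality of functions on the closed disk.
\<close>

definition disk_algebra :: "(complex \<Rightarrow> complex) set" where
  "disk_algebra = {f. f holomorphic_on ball 0 1 \<and> continuous_on (cball 0 1) f \<and>
                      (\<forall>z. z \<notin> cball 0 1 \<longrightarrow> f z = 0)}"

definition cyc_len :: "nat \<Rightarrow> nat \<Rightarrow> nat \<Rightarrow> nat" where
  "cyc_len n i j = nat ((int j - int i) mod int n)"

text \<open>
  Rows and columns are numbered from 1 to \<open>n\<close>, whereas entries of the type \<open>mat\<close> are indexed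
  from 0.  Outside the closed unit disk the value is the zero matrix as soon as all the
  \<open>f i j\<close> lie in the disk algebra.
\<close>

definition cyc_mat ::
  "nat \<Rightarrow> (nat \<Rightarrow> nat \<Rightarrow> complex \<Rightarrow> complex) \<Rightarrow> complex \<Rightarrow> complex mat" where
  "cyc_mat n f = (\<lambda>z. mat n n (\<lambda>(a, b).
     z ^ cyc_len n (Suc a) (Suc b) * f (Suc a) (Suc b) (z ^ n)))"

definition cyc_alg :: "nat \<Rightarrow> (complex \<Rightarrow> complex mat) set" where
  "cyc_alg n = {cyc_mat n f | f. \<forall>i\<in>{1..n}. \<forall>j\<in>{1..n}. f i j \<in> disk_algebra}"

definition l2_norm :: "complex vec \<Rightarrow> real" where
  "l2_norm v = L2_set (\<lambda>k. cmod (v $ k)) {..<dim_vec v}"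

definition mat_opnorm :: "nat \<Rightarrow> complex mat \<Rightarrow> real" where
  "mat_opnorm n A = (SUP v\<in>{v \<in> carrier_vec n. l2_norm v \<le> 1}. l2_norm (A *\<^sub>v v))"

definition cyc_norm :: "nat \<Rightarrow> (complex \<Rightarrow> complex mat) \<Rightarrow> real" where
  "cyc_norm n F = (SUP z\<in>cball 0 1. mat_opnorm n (F z))"

text \<open>
  The locale \<^locale>\<open>Metric_space\<close> asks for nonnegativity and symmetry of the distance also
  outside the carrier, hence the case distinction.
\<close>

definition cyc_dist ::
  "nat \<Rightarrow> (complex \<Rightarrow> complex mat) \<Rightarrow> (complex \<Rightarrow> complex mat) \<Rightarrow> real" where
  "cyc_dist n F G =
     (if F \<in> cyc_alg n \<and> G \<in> cyc_alg n then cyc_norm n (\<lambda>z. F z - G z) else 0)"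

definition cyc_top :: "nat \<Rightarrow> (complex \<Rightarrow> complex mat) topology" where
  "cyc_top n = Metric_space.mtopology (cyc_alg n) (cyc_dist n)"

definition phi :: "nat \<Rightarrow> nat \<Rightarrow> (complex \<Rightarrow> complex mat) \<Rightarrow> complex" where
  "phi n i F = (THE c. \<exists>f. (\<forall>k\<in>{1..n}. \<forall>l\<in>{1..n}. f k l \<in> disk_algebra) \<and>
                           F = cyc_mat n f \<and> c = f i i 0)"

definition point_derivation ::
  "nat \<Rightarrow> ((complex \<Rightarrow> complex mat) \<Rightarrow> complex) \<Rightarrow> ((complex \<Rightarrow> complex mat) \<Rightarrow> complex) \<Rightarrow> bool" where
  "point_derivation n \<pi> D \<longleftrightarrow>
     (\<forall>F\<in>cyc_alg n. \<forall>G\<in>cyc_alg n. D (\<lambda>z. F z + G z) = D F + D G) \<and>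
     (\<forall>c. \<forall>F\<in>cyc_alg n. D (\<lambda>z. c \<cdot>\<^sub>m F z) = c * D F) \<and>
     continuous_map (cyc_top n) euclidean D \<and>
     (\<forall>F\<in>cyc_alg n. \<forall>G\<in>cyc_alg n. D (\<lambda>z. F z * G z) = D F * \<pi> G + \<pi> F * D G)"

text \<open>The definite description in \<^const>\<open>phi\<close> is well defined.\<close>

lemma phi_cyc_mat:
  assumes "1 \<le> i" "i \<le> n" and f: "\<And>k l. k \<in> {1..n} \<Longrightarrow> l \<in> {1..n} \<Longrightarrow> f k l \<in> disk_algebra"
  shows "phi n i (cyc_mat n f) = f i i 0"
proof -
  have diag: "cyc_mat n g 0 $$ (i - 1, i - 1) = g i i 0" for g
    using assms(1,2) by (simp add: cyc_mat_def cyc_len_def power_0_left)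
  show ?thesis
    unfolding phi_def
  proof (rule the_equality)
    show "\<exists>g. (\<forall>k\<in>{1..n}. \<forall>l\<in>{1..n}. g k l \<in> disk_algebra) \<and>
              cyc_mat n f = cyc_mat n g \<and> f i i 0 = g i i 0"
      using f by blast
  qed (metis diag)
qed

text \<open>The suprema are finite and \<^const>\<open>cyc_dist\<close> is a metric.\<close>

lemma l2_norm_nonneg: "0 \<le> l2_norm v"
  by (simp add: l2_norm_def L2_set_nonneg)

lemma l2_norm_zero: "l2_norm (0\<^sub>v n) = 0"
  by (simp add: l2_norm_def L2_set_def)

lemma cmod_le_l2_norm: "k < dim_vec v \<Longrightarrow> cmod (v $ k) \<le> l2_norm v"
  unfolding l2_norm_def by (rule member_le_L2_set) auto

lemma l2_norm_add:
  assumes "v \<in> carrier_vec n" "w \<in> carrier_vec n"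
  shows "l2_norm (v + w) \<le> l2_norm v + l2_norm w"
proof -
  have "l2_norm (v + w) = L2_set (\<lambda>k. cmod (v $ k + w $ k)) {..<n}"
    using assms by (auto simp: l2_norm_def intro!: L2_set_cong)
  also have "\<dots> \<le> L2_set (\<lambda>k. cmod (v $ k) + cmod (w $ k)) {..<n}"
    by (rule L2_set_mono) (auto intro: norm_triangle_ineq)
  also have "\<dots> \<le> l2_norm v + l2_norm w"
    using assms L2_set_triangle_ineq[of "\<lambda>k. cmod (v $ k)" "\<lambda>k. cmod (w $ k)" "{..<n}"]
    by (simp add: l2_norm_def)
  finally show ?thesis .
qed

lemma l2_norm_mult_le:
  assumes A: "A \<in> carrier_mat n n" and v: "v \<in> carrier_vec n" "l2_norm v \<le> 1"
  shows "l2_norm (A *\<^sub>v v) \<le> (\<Sum>a<n. \<Sum>b<n. cmod (A $$ (a, b)))"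
proof -
  have "l2_norm (A *\<^sub>v v) \<le> (\<Sum>a<n. cmod ((A *\<^sub>v v) $ a))"
    using A L2_set_le_sum[of "{..<n}" "\<lambda>k. cmod ((A *\<^sub>v v) $ k)"] by (simp add: l2_norm_def)
  also have "\<dots> \<le> (\<Sum>a<n. \<Sum>b<n. cmod (A $$ (a, b)))"
  proof (rule sum_mono)
    fix a assume "a \<in> {..<n}"
    then have "(A *\<^sub>v v) $ a = (\<Sum>b<n. A $$ (a, b) * v $ b)"
      using A v by (auto simp: scalar_prod_def lessThan_atLeast0 intro!: sum.cong)
    then have "cmod ((A *\<^sub>v v) $ a) \<le> (\<Sum>b<n. cmod (A $$ (a, b)) * cmod (v $ b))"
      by (simp only:) (metis (mono_tags, lifting) norm_mult norm_sum sum.cong)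
    also have "\<dots> \<le> (\<Sum>b<n. cmod (A $$ (a, b)))"
    proof (rule sum_mono)
      fix b assume "b \<in> {..<n}"
      then have "cmod (v $ b) \<le> 1"
        using v cmod_le_l2_norm[of b v] by auto
      then show "cmod (A $$ (a, b)) * cmod (v $ b) \<le> cmod (A $$ (a, b))"
        by (simp add: mult_left_le)
    qed
    finally show "cmod ((A *\<^sub>v v) $ a) \<le> (\<Sum>b<n. cmod (A $$ (a, b)))" .
  qed
  finally show ?thesis .
qed

lemma mat_opnorm_upper:
  assumes A: "A \<in> carrier_mat n n" and v: "v \<in> carrier_vec n" "l2_norm v \<le> 1"
  shows "l2_norm (A *\<^sub>v v) \<le> mat_opnorm n A"
  unfolding mat_opnorm_def
  using v l2_norm_mult_le[OF A] by (intro cSUP_upper bdd_aboveI2) auto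

lemma mat_opnorm_least:
  assumes "\<And>v. v \<in> carrier_vec n \<Longrightarrow> l2_norm v \<le> 1 \<Longrightarrow> l2_norm (A *\<^sub>v v) \<le> c"
  shows "mat_opnorm n A \<le> c"
proof -
  have "0\<^sub>v n \<in> {v \<in> carrier_vec n. l2_norm v \<le> 1}"
    by (simp add: l2_norm_zero)
  then show ?thesis
    unfolding mat_opnorm_def using assms by (intro cSUP_least) blast+
qed

lemma mat_opnorm_nonneg: "A \<in> carrier_mat n n \<Longrightarrow> 0 \<le> mat_opnorm n A"
  using mat_opnorm_upper[of A n "0\<^sub>v n"] l2_norm_nonneg[of "A *\<^sub>v 0\<^sub>v n"]
  by (simp add: l2_norm_zero)

lemma mat_opnorm_add:
  assumes "A \<in> carrier_mat n n" "B \<in> carrier_mat n n"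
  shows "mat_opnorm n (A + B) \<le> mat_opnorm n A + mat_opnorm n B"
proof (rule mat_opnorm_least)
  fix v assume v: "v \<in> carrier_vec n" "l2_norm v \<le> 1"
  have "l2_norm ((A + B) *\<^sub>v v) \<le> l2_norm (A *\<^sub>v v) + l2_norm (B *\<^sub>v v)"
    using assms v l2_norm_add[of "A *\<^sub>v v" n "B *\<^sub>v v"] by (simp add: add_mult_distrib_mat_vec)
  then show "l2_norm ((A + B) *\<^sub>v v) \<le> mat_opnorm n A + mat_opnorm n B"
    using mat_opnorm_upper[OF assms(1) v] mat_opnorm_upper[OF assms(2) v] by linarith
qed

lemma entry_le_mat_opnorm:
  assumes A: "A \<in> carrier_mat n n" and "a < n" "b < n"
  shows "cmod (A $$ (a, b)) \<le> mat_opnorm n A"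
proof -
  have "l2_norm (unit_vec n b) = L2_set (\<lambda>k. if k = b then 1 else 0) {..<n}"
    using assms by (auto simp: l2_norm_def intro!: L2_set_cong)
  also have "\<dots> = 1"
    using assms by (simp add: L2_set_def if_distrib[of "\<lambda>x. x\<^sup>2"] cong: if_cong)
  finally have u: "unit_vec n b \<in> carrier_vec n" "l2_norm (unit_vec n b) \<le> 1"
    by auto
  have "(A *\<^sub>v unit_vec n b) $ a = A $$ (a, b)"
    using assms by simp
  then show ?thesis
    using cmod_le_l2_norm[of a "A *\<^sub>v unit_vec n b"] mat_opnorm_upper[OF A u] assms by simp
qed

lemma mat_opnorm_le_sum:
  "A \<in> carrier_mat n n \<Longrightarrow> mat_opnorm n A \<le> (\<Sum>a<n. \<Sum>b<n. cmod (A $$ (a, b)))"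
  by (rule mat_opnorm_least) (rule l2_norm_mult_le)

lemma cyc_alg_carrier: "F \<in> cyc_alg n \<Longrightarrow> F z \<in> carrier_mat n n"
  by (auto simp: cyc_alg_def cyc_mat_def)

lemma cyc_alg_outside:
  assumes "F \<in> cyc_alg n" "z \<notin> cball 0 1"
  shows "F z = 0\<^sub>m n n"
proof (cases "n = 0")
  case True
  with cyc_alg_carrier[OF assms(1), of z] show ?thesis by auto
next
  case False
  have "1 < cmod (z ^ n)"
    using assms(2) False by (simp add: norm_power one_less_power)
  with assms(1) show ?thesis
    by (auto simp: cyc_alg_def cyc_mat_def disk_algebra_def Ball_def intro!: eq_matI)
qed

lemma cyc_alg_entry_continuous:
  assumes "F \<in> cyc_alg n" "a < n" "b < n"
  shows "continuous_on (cball 0 1) (\<lambda>z. F z $$ (a, b))"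
proof -
  obtain f where F: "F = cyc_mat n f" and f: "\<forall>i\<in>{1..n}. \<forall>j\<in>{1..n}. f i j \<in> disk_algebra"
    using assms(1) by (auto simp: cyc_alg_def)
  have "continuous_on (cball 0 1) (f (Suc a) (Suc b))"
    using f assms by (auto simp: disk_algebra_def)
  then have "continuous_on (cball 0 1) (\<lambda>z. f (Suc a) (Suc b) (z ^ n))"
    by (rule continuous_on_compose2) (auto simp: norm_power power_le_one intro!: continuous_intros)
  then show ?thesis
    using assms by (auto simp: F cyc_mat_def intro!: continuous_intros)
qed

lemma cyc_dist_bdd:
  assumes F: "F \<in> cyc_alg n" and G: "G \<in> cyc_alg n"
  shows "bdd_above ((\<lambda>z. mat_opnorm n (F z - G z)) ` cball 0 1)"
proof -
  let ?s = "\<lambda>z. \<Sum>a<n. \<Sum>b<n. cmod (F z $$ (a, b) - G z $$ (a, b))"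
  have "continuous_on (cball 0 1) ?s"
    using F G by (intro continuous_intros cyc_alg_entry_continuous) auto
  then have "compact (?s ` cball 0 1)"
    by (intro compact_continuous_image) auto
  then have "bdd_above (?s ` cball 0 1)"
    by (intro bounded_imp_bdd_above compact_imp_bounded)
  then obtain M where M: "\<And>z. z \<in> cball 0 1 \<Longrightarrow> ?s z \<le> M"
    unfolding bdd_above_def by (meson imageI)
  have "mat_opnorm n (F z - G z) \<le> ?s z" for z
    using mat_opnorm_le_sum[of "F z - G z" n] cyc_alg_carrier[OF F, of z] cyc_alg_carrier[OF G, of z]
    by (simp add: minus_carrier_mat)
  with M show ?thesis
    by (intro bdd_aboveI2[of _ _ M]) (meson order_trans)
qed

lemma cyc_dist_upper:
  assumes "F \<in> cyc_alg n" "G \<in> cyc_alg n" "z \<in> cball 0 1"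
  shows "mat_opnorm n (F z - G z) \<le> cyc_dist n F G"
  using assms cSUP_upper[OF _ cyc_dist_bdd, of z F n G] by (simp add: cyc_dist_def cyc_norm_def)

lemma cyc_dist_least:
  assumes "F \<in> cyc_alg n" "G \<in> cyc_alg n"
    and "\<And>z. z \<in> cball 0 1 \<Longrightarrow> mat_opnorm n (F z - G z) \<le> c"
  shows "cyc_dist n F G \<le> c"
proof -
  have "(SUP z\<in>cball 0 1. mat_opnorm n (F z - G z)) \<le> c"
    by (rule cSUP_least) (use assms(3) in auto)
  then show ?thesis
    using assms by (simp add: cyc_dist_def cyc_norm_def)
qed

lemma mat_opnorm_diff_triangle:
  assumes "A \<in> carrier_mat n n" "B \<in> carrier_mat n n" "C \<in> carrier_mat n n"
  shows "mat_opnorm n (A - C) \<le> mat_opnorm n (A - B) + mat_opnorm n (B - C)"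
proof -
  have "A - C = (A - B) + (B - C)"
    using assms by (intro eq_matI) auto
  then show ?thesis
    using mat_opnorm_add[of "A - B" n "B - C"] assms by (simp add: minus_carrier_mat)
qed

lemma mat_opnorm_diff_commute:
  assumes "A \<in> carrier_mat n n" "B \<in> carrier_mat n n"
  shows "mat_opnorm n (A - B) = mat_opnorm n (B - A)"
proof -
  have "l2_norm ((A - B) *\<^sub>v v) = l2_norm ((B - A) *\<^sub>v v)" if "v \<in> carrier_vec n" for v
    using assms that
    by (auto simp: l2_norm_def minus_mult_distrib_mat_vec norm_minus_commute intro!: L2_set_cong)
  then show ?thesis
    unfolding mat_opnorm_def by (intro SUP_cong) auto
qed

lemma cyc_dist_nonneg: "0 \<le> cyc_dist n F G"
proof (cases "F \<in> cyc_alg n \<and> G \<in> cyc_alg n")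
  case True
  then have "0 \<le> mat_opnorm n (F 0 - G 0)"
    by (intro mat_opnorm_nonneg minus_carrier_mat cyc_alg_carrier) auto
  also have "\<dots> \<le> cyc_dist n F G"
    using True by (intro cyc_dist_upper) auto
  finally show ?thesis .
qed (auto simp: cyc_dist_def)

lemma cyc_dist_commute: "cyc_dist n F G = cyc_dist n G F"
proof (cases "F \<in> cyc_alg n \<and> G \<in> cyc_alg n")
  case True
  then have "mat_opnorm n (F z - G z) = mat_opnorm n (G z - F z)" for z
    by (intro mat_opnorm_diff_commute cyc_alg_carrier) auto
  then show ?thesis
    by (simp add: cyc_dist_def cyc_norm_def conj_commute)
qed (auto simp: cyc_dist_def)

lemma cyc_dist_zero:
  assumes F: "F \<in> cyc_alg n" and G: "G \<in> cyc_alg n"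
  shows "cyc_dist n F G = 0 \<longleftrightarrow> F = G"
proof
  assume d: "cyc_dist n F G = 0"
  show "F = G"
  proof
    fix z
    note carr = cyc_alg_carrier[OF F, of z] cyc_alg_carrier[OF G, of z]
    show "F z = G z"
    proof (cases "z \<in> cball 0 1")
      case True
      show ?thesis
      proof (rule eq_matI)
        fix a b assume "a < dim_row (G z)" "b < dim_col (G z)"
        then have ab: "a < n" "b < n" using carr by auto
        then have "cmod ((F z - G z) $$ (a, b)) \<le> mat_opnorm n (F z - G z)"
          using carr by (intro entry_le_mat_opnorm) auto
        with cyc_dist_upper[OF F G True] d have "cmod ((F z - G z) $$ (a, b)) \<le> 0" by linarith
        then show "F z $$ (a, b) = G z $$ (a, b)" using ab carr by simp
      qed (use carr in auto)
    next
      case False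
      then show ?thesis using cyc_alg_outside F G by metis
    qed
  qed
next
  assume FG: "F = G"
  have "mat_opnorm n (F z - F z) \<le> 0" for z
    using mat_opnorm_le_sum[of "F z - F z" n] cyc_alg_carrier[OF F, of z] by simp
  then have "cyc_dist n F F \<le> 0"
    using F by (intro cyc_dist_least) auto
  with FG show "cyc_dist n F G = 0"
    using cyc_dist_nonneg[of n F F] by simp
qed

lemma Metric_space_cyc_alg: "Metric_space (cyc_alg n) (cyc_dist n)"
proof
  show "cyc_dist n F H \<le> cyc_dist n F G + cyc_dist n G H"
    if "F \<in> cyc_alg n" "G \<in> cyc_alg n" "H \<in> cyc_alg n" for F G H
  proof (rule cyc_dist_least)
    fix z :: complex assume z: "z \<in> cball 0 1"
    have "mat_opnorm n (F z - H z) \<le> mat_opnorm n (F z - G z) + mat_opnorm n (G z - H z)"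
      using that by (intro mat_opnorm_diff_triangle cyc_alg_carrier)
    with cyc_dist_upper[OF that(1,2) z] cyc_dist_upper[OF that(2,3) z]
    show "mat_opnorm n (F z - H z) \<le> cyc_dist n F G + cyc_dist n G H"
      by linarith
  qed (use that in auto)
qed (simp_all add: cyc_dist_nonneg cyc_dist_commute cyc_dist_zero)

end

theory Submission
  imports Defs "HOL-Complex_Analysis.Cauchy_Integral_Formula"
begin

text \<open>
  Write \<open>E k l\<close> for the matrix units. A derivation at \<open>\<phi>\<close> kills every idempotent at which \<open>\<phi>\<close> is
  0 or 1, so it kills \<open>E i i\<close> and only sees the corner entry \<open>f i i\<close>. Writing
  \<open>f i i (w) = f i i (0) + w g (w)\<close> and choosing \<open>j \<noteq> i\<close>, the nonconstant part of the corner
  is the product of \<open>z ^ \<ell>(i, j) E i j\<close> and \<open>z ^ \<ell>(j, i) g (z ^ n) E j i\<close>, because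
  \<open>\<ell>(i, j) + \<ell>(j, i) = n\<close>. Both factors have zero diagonal, so the derivation kills their product.
\<close>

lemma zero_in_disk_algebra: "(\<lambda>_. 0) \<in> disk_algebra"
  by (simp add: disk_algebra_def)

text \<open>Functions are extended by zero off the closed disk, so the unit of the disk algebra is
  this indicator and not the constant 1.\<close>

lemma indicator_in_disk_algebra: "indicator (cball 0 1) \<in> disk_algebra"
proof -
  have "(indicator (cball 0 1) :: complex \<Rightarrow> complex) holomorphic_on ball 0 1"
    by (rule holomorphic_transform[of "\<lambda>_. 1"]) auto
  moreover have "continuous_on (cball 0 1) (indicator (cball 0 1) :: complex \<Rightarrow> complex)"
    by (rule continuous_on_eq[of _ "\<lambda>_. 1"]) auto
  ultimately show ?thesis
    by (simp add: disk_algebra_def)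
qed

text \<open>The difference quotient at 0 has a removable singularity, filled by the derivative, and
  up to the boundary it is continuous because its denominator vanishes only at 0.\<close>

lemma disk_algebra_factor:
  assumes f: "f \<in> disk_algebra"
  obtains g where "g \<in> disk_algebra" "\<And>w. w \<in> cball 0 1 \<Longrightarrow> f w = f 0 + w * g w"
proof
  define q where "q = (\<lambda>w. if w = 0 then deriv f 0 else (f w - f 0) / w)"
  define g where "g = (\<lambda>w. if w \<in> cball 0 1 then q w else 0)"
  have hol: "f holomorphic_on ball 0 1" and cont: "continuous_on (cball 0 1) f"
    using f by (auto simp: disk_algebra_def)
  have q_hol: "q holomorphic_on ball 0 1"
    using pole_lemma_open[OF hol open_ball, of 0] unfolding diff_zero q_def .
  have "continuous (at w within cball 0 1) q" if w: "w \<in> cball 0 1" for w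
  proof (cases "w = 0")
    case True
    have "continuous_on (ball 0 1) q"
      using q_hol by (rule holomorphic_on_imp_continuous_on)
    then have "isCont q 0"
      by (simp add: continuous_on_eq_continuous_at)
    with True show ?thesis
      by (simp add: continuous_at_imp_continuous_at_within)
  next
    case False
    have "continuous_on (cball 0 1 - {0}) (\<lambda>w. (f w - f 0) / w)"
      by (intro continuous_intros continuous_on_subset[OF cont]) auto
    then have "continuous_on (cball 0 1 - {0}) q"
      by (rule continuous_on_eq) (auto simp: q_def)
    then have "continuous (at w within cball 0 1 - {0}) q"
      using w False by (simp add: continuous_on_eq_continuous_within)
    \<comment> \<open>Puncturing the disk at 0 does not change neighbourhoods of a point other than
      0.\<close>
    moreover have "at w within cball 0 1 - {0} = at w within cball 0 1"
      using False by (intro at_within_nhd[of w "- {0}"]) auto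
    ultimately show ?thesis
      by simp
  qed
  then have "continuous_on (cball 0 1) q"
    by (simp add: continuous_on_eq_continuous_within)
  then have "continuous_on (cball 0 1) g"
    by (rule continuous_on_eq) (auto simp: g_def)
  moreover have "g holomorphic_on ball 0 1"
    by (rule holomorphic_transform[OF q_hol]) (auto simp: g_def)
  ultimately show "g \<in> disk_algebra"
    by (simp add: disk_algebra_def g_def)
  show "f w = f 0 + w * g w" if "w \<in> cball 0 1" for w
    using that by (simp add: g_def q_def)
qed

lemma cyc_len_self [simp]: "cyc_len n i i = 0"
  by (simp add: cyc_len_def)

text \<open>For \<open>k < l\<close> the two residues are \<open>l - k\<close> and
  \<open>k - l + n\<close>. For equal indices both would be 0, hence the assumption
  \<open>i \<noteq> j\<close>.\<close>

lemma cyc_len_add_swap: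
  assumes "i \<in> {1..n}" "j \<in> {1..n}" "i \<noteq> j"
  shows "cyc_len n i j + cyc_len n j i = n"
proof -
  have *: "cyc_len n k l + cyc_len n l k = n" if "k < l" "1 \<le> k" "l \<le> n" for k l
  proof -
    have "(int l - int k) mod int n = int l - int k"
      using that by (intro mod_pos_pos_trivial) auto
    moreover have "(int k - int l) mod int n = int k - int l + int n"
      using that mod_add_self2[of "int k - int l" "int n"]
        mod_pos_pos_trivial[of "int k - int l + int n" "int n"] by linarith
    ultimately show ?thesis
      using that by (simp add: cyc_len_def)
  qed
  show ?thesis
    using assms *[of i j] *[of j i] by (cases i j rule: linorder_cases) (auto simp: add.commute)
qed

text \<open>Here \<open>g\<close> is the coefficient, not the entry: the matrix is z^l(i,j) g(z^n)
  E_ij, the power of z being supplied by \<open>cyc_mat\<close>.\<close>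

definition cyc_unit :: "nat \<Rightarrow> nat \<Rightarrow> nat \<Rightarrow> (complex \<Rightarrow> complex) \<Rightarrow> complex \<Rightarrow> complex mat" where
  "cyc_unit n i j g = cyc_mat n (\<lambda>k l. if k = i \<and> l = j then g else (\<lambda>_. 0))"

lemma cyc_mat_in_cyc_alg:
  "(\<And>i j. i \<in> {1..n} \<Longrightarrow> j \<in> {1..n} \<Longrightarrow> f i j \<in> disk_algebra) \<Longrightarrow> cyc_mat n f \<in> cyc_alg n"
  by (auto simp: cyc_alg_def)

lemma cyc_unit_in_cyc_alg: "g \<in> disk_algebra \<Longrightarrow> cyc_unit n i j g \<in> cyc_alg n"
  by (auto simp: cyc_unit_def zero_in_disk_algebra intro!: cyc_mat_in_cyc_alg)

lemma phi_cyc_unit: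
  assumes "1 \<le> k" "k \<le> n" "g \<in> disk_algebra"
  shows "phi n k (cyc_unit n i j g) = (if i = k \<and> j = k then g 0 else 0)"
  using assms by (simp add: cyc_unit_def phi_cyc_mat zero_in_disk_algebra)

lemma cyc_mat_dim [simp]: "dim_row (cyc_mat n f z) = n" "dim_col (cyc_mat n f z) = n"
  by (simp_all add: cyc_mat_def)

lemma cyc_mat_entry:
  "a < n \<Longrightarrow> b < n \<Longrightarrow>
    cyc_mat n f z $$ (a, b) = z ^ cyc_len n (Suc a) (Suc b) * f (Suc a) (Suc b) (z ^ n)"
  by (simp add: cyc_mat_def)

lemma cyc_mat_mult_entry:
  assumes "a < n" "b < n"
  shows "(cyc_mat n f z * cyc_mat n g z) $$ (a, b) =
    (\<Sum>k<n. cyc_mat n f z $$ (a, k) * cyc_mat n g z $$ (k, b))"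
  using assms by (auto simp: scalar_prod_def lessThan_atLeast0 intro!: sum.cong)

text \<open>Left multiplication by E_ii keeps only row \<open>i\<close>. Where z^n leaves the closed
  disk the indicator is 0, but so is every \<open>f k l\<close> in the disk algebra; thus the
  identity holds at all z.\<close>

lemma cyc_unit_mult_cyc_mat:
  assumes i: "i \<in> {1..n}" and f: "\<And>k l. k \<in> {1..n} \<Longrightarrow> l \<in> {1..n} \<Longrightarrow> f k l \<in> disk_algebra"
  shows "cyc_unit n i i (indicator (cball 0 1)) z * cyc_mat n f z =
    cyc_mat n (\<lambda>k l. if k = i then f k l else (\<lambda>_. 0)) z"
proof (rule eq_matI)
  fix a b assume "a < dim_row (cyc_mat n (\<lambda>k l. if k = i then f k l else (\<lambda>_. 0)) z)"
    "b < dim_col (cyc_mat n (\<lambda>k l. if k = i then f k l else (\<lambda>_. 0)) z)"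
  then have ab: "a < n" "b < n" by auto
  have zero: "f (Suc a) (Suc b) (z ^ n) = 0" if "z ^ n \<notin> cball 0 1"
    using f[of "Suc a" "Suc b"] ab that by (auto simp: disk_algebra_def)
  have "(cyc_unit n i i (indicator (cball 0 1)) z * cyc_mat n f z) $$ (a, b) =
    (\<Sum>k<n. if k = a then (if Suc a = i then indicator (cball 0 1) (z ^ n) * cyc_mat n f z $$ (a, b) else 0) else 0)"
    unfolding cyc_unit_def cyc_mat_mult_entry[OF ab]
    using ab i by (intro sum.cong) (auto simp: cyc_mat_entry)
  also have "\<dots> = cyc_mat n (\<lambda>k l. if k = i then f k l else (\<lambda>_. 0)) z $$ (a, b)"
    using ab zero by (auto simp: cyc_mat_entry indicator_def)
  finally show "(cyc_unit n i i (indicator (cball 0 1)) z * cyc_mat n f z) $$ (a, b) =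
    cyc_mat n (\<lambda>k l. if k = i then f k l else (\<lambda>_. 0)) z $$ (a, b)" .
qed (simp_all add: cyc_unit_def)

lemma cyc_mat_mult_cyc_unit:
  assumes i: "i \<in> {1..n}" and f: "\<And>k l. k \<in> {1..n} \<Longrightarrow> l \<in> {1..n} \<Longrightarrow> f k l \<in> disk_algebra"
  shows "cyc_mat n f z * cyc_unit n i i (indicator (cball 0 1)) z =
    cyc_mat n (\<lambda>k l. if l = i then f k l else (\<lambda>_. 0)) z"
proof (rule eq_matI)
  fix a b assume "a < dim_row (cyc_mat n (\<lambda>k l. if l = i then f k l else (\<lambda>_. 0)) z)"
    "b < dim_col (cyc_mat n (\<lambda>k l. if l = i then f k l else (\<lambda>_. 0)) z)"
  then have ab: "a < n" "b < n" by auto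
  have zero: "f (Suc a) (Suc b) (z ^ n) = 0" if "z ^ n \<notin> cball 0 1"
    using f[of "Suc a" "Suc b"] ab that by (auto simp: disk_algebra_def)
  have "(cyc_mat n f z * cyc_unit n i i (indicator (cball 0 1)) z) $$ (a, b) =
    (\<Sum>k<n. if k = b then (if Suc b = i then cyc_mat n f z $$ (a, b) * indicator (cball 0 1) (z ^ n) else 0) else 0)"
    unfolding cyc_unit_def cyc_mat_mult_entry[OF ab]
    using ab i by (intro sum.cong) (auto simp: cyc_mat_entry)
  also have "\<dots> = cyc_mat n (\<lambda>k l. if l = i then f k l else (\<lambda>_. 0)) z $$ (a, b)"
    using ab zero by (auto simp: cyc_mat_entry indicator_def)
  finally show "(cyc_mat n f z * cyc_unit n i i (indicator (cball 0 1)) z) $$ (a, b) =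
    cyc_mat n (\<lambda>k l. if l = i then f k l else (\<lambda>_. 0)) z $$ (a, b)" .
qed (simp_all add: cyc_unit_def)

text \<open>Going from \<open>i\<close> to \<open>j\<close> and back runs once around the cycle and
  contributes z^n, which appears as the factor \<open>w\<close> in the coefficient.\<close>

lemma cyc_unit_mult_cyc_unit:
  assumes "i \<in> {1..n}" "j \<in> {1..n}" "i \<noteq> j"
  shows "cyc_unit n i j g z * cyc_unit n j i h z = cyc_unit n i i (\<lambda>w. w * g w * h w) z"
proof (rule eq_matI)
  fix a b assume "a < dim_row (cyc_unit n i i (\<lambda>w. w * g w * h w) z)"
    "b < dim_col (cyc_unit n i i (\<lambda>w. w * g w * h w) z)"
  then have ab: "a < n" "b < n" by (auto simp: cyc_unit_def)
  have pow: "z ^ cyc_len n i j * g (z ^ n) * (z ^ cyc_len n j i * h (z ^ n)) =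
      z ^ n * g (z ^ n) * h (z ^ n)"
    using cyc_len_add_swap[OF assms]
    by (metis (no_types, lifting) mult.assoc mult.left_commute power_add)
  have "(cyc_unit n i j g z * cyc_unit n j i h z) $$ (a, b) =
    (\<Sum>k<n. if k = j - 1 then (if Suc a = i \<and> Suc b = i then z ^ n * g (z ^ n) * h (z ^ n) else 0) else 0)"
    unfolding cyc_unit_def cyc_mat_mult_entry[OF ab]
    using ab assms by (intro sum.cong) (auto simp: cyc_mat_entry pow)
  also have "\<dots> = cyc_unit n i i (\<lambda>w. w * g w * h w) z $$ (a, b)"
    using ab assms by (auto simp: cyc_mat_entry cyc_unit_def)
  finally show "(cyc_unit n i j g z * cyc_unit n j i h z) $$ (a, b) =
    cyc_unit n i i (\<lambda>w. w * g w * h w) z $$ (a, b)" .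
qed (simp_all add: cyc_unit_def)

lemma cyc_unit_add: "cyc_unit n i j g z + cyc_unit n i j h z = cyc_unit n i j (\<lambda>w. g w + h w) z"
  by (intro eq_matI) (auto simp: cyc_unit_def cyc_mat_entry algebra_simps)

lemma cyc_unit_smult: "c \<cdot>\<^sub>m cyc_unit n i j g z = cyc_unit n i j (\<lambda>w. c * g w) z"
  by (intro eq_matI) (auto simp: cyc_unit_def cyc_mat_entry)

theorem proposition6:
  fixes n i :: nat and D :: "(complex \<Rightarrow> complex mat) \<Rightarrow> complex"
  assumes "n \<ge> 2" and "1 \<le> i" and "i \<le> n"
    and "point_derivation n (phi n i) D"
  shows "\<forall>F\<in>cyc_alg n. D F = 0"
proof
  fix F assume F: "F \<in> cyc_alg n"
  let ?one = "indicator (cball 0 1) :: complex \<Rightarrow> complex"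
  let ?e = "cyc_unit n i i ?one"
  have i: "i \<in> {1..n}"
    using assms by simp
  have add: "D (\<lambda>z. F z + G z) = D F + D G"
    and mult: "D (\<lambda>z. F z * G z) = D F * phi n i G + phi n i F * D G"
    if "F \<in> cyc_alg n" "G \<in> cyc_alg n" for F G
    using assms(4) that by (auto simp: point_derivation_def)
  have smult: "D (\<lambda>z. c \<cdot>\<^sub>m F z) = c * D F" if "F \<in> cyc_alg n" for c F
    using assms(4) that by (auto simp: point_derivation_def)
  note one = indicator_in_disk_algebra
  have e: "?e \<in> cyc_alg n"
    using one by (rule cyc_unit_in_cyc_alg)
  have phi_e: "phi n i ?e = 1"
    using assms one by (simp add: phi_cyc_unit)
  have "(\<lambda>z. ?e z * ?e z) = ?e"
  proof
    fix z
    have "?e z * ?e z = cyc_mat n (\<lambda>k l. if k = i then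
        (if k = i \<and> l = i then ?one else (\<lambda>_. 0)) else (\<lambda>_. 0)) z"
      \<comment> \<open>Only the right factor is unfolded, so that the left one still matches the
        rule.\<close>
      by (subst (2) cyc_unit_def, rule cyc_unit_mult_cyc_mat[OF i])
        (auto simp: one zero_in_disk_algebra)
    also have "\<dots> = ?e z"
      by (simp add: cyc_unit_def) (metis (no_types, lifting))
    finally show "?e z * ?e z = ?e z" .
  qed
  \<comment> \<open>The product rule for the idempotent reads D e = 2 D e.\<close>
  then have De: "D ?e = 0"
    using mult[OF e e] phi_e by simp

  obtain f where F_eq: "F = cyc_mat n f"
    and f: "\<And>k l. k \<in> {1..n} \<Longrightarrow> l \<in> {1..n} \<Longrightarrow> f k l \<in> disk_algebra"
    using F by (auto simp: cyc_alg_def)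
  define R where "R = cyc_mat n (\<lambda>k l. if k = i then f k l else (\<lambda>_. 0))"
  have R: "R \<in> cyc_alg n"
    unfolding R_def by (rule cyc_mat_in_cyc_alg) (simp add: f zero_in_disk_algebra)
  have "(\<lambda>z. ?e z * F z) = R"
    unfolding F_eq R_def by (intro ext cyc_unit_mult_cyc_mat i f)
  \<comment> \<open>As D e = 0 and phi(e) = 1, multiplying by e on either side leaves the value of D
    unchanged.\<close>
  then have "D R = D F"
    using mult[OF e F] De phi_e by simp
  moreover have "(\<lambda>z. R z * ?e z) = cyc_unit n i i (f i i)"
  proof
    fix z
    have "R z * ?e z = cyc_mat n (\<lambda>k l. if l = i then
        (if k = i then f k l else (\<lambda>_. 0)) else (\<lambda>_. 0)) z"
      unfolding R_def by (rule cyc_mat_mult_cyc_unit[OF i]) (simp add: f zero_in_disk_algebra)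
    also have "\<dots> = cyc_unit n i i (f i i) z"
      by (auto simp: cyc_unit_def cyc_mat_entry intro!: eq_matI)
    finally show "R z * ?e z = cyc_unit n i i (f i i) z" .
  qed
  then have "D (cyc_unit n i i (f i i)) = D R"
    using mult[OF R e] De phi_e by simp
  moreover have "D (cyc_unit n i i (f i i)) = 0"
  proof -
    \<comment> \<open>This is where \<open>n \<ge> 2\<close> enters. For n = 1 the algebra is the
      disk algebra, and f \<mapsto> f'(0) is a nonzero point derivation at evaluation at 0.\<close>
    obtain j where j: "j \<in> {1..n}" "i \<noteq> j"
    proof
      show "(if i = 1 then 2 else 1) \<in> {1..n}" "i \<noteq> (if i = 1 then 2 else 1)"
        using assms(1) by auto
    qed
    have fi: "f i i \<in> disk_algebra"
      using f i by blast
    then obtain g where g: "g \<in> disk_algebra" "\<And>w. w \<in> cball 0 1 \<Longrightarrow> f i i w = f i i 0 + w * g w"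
      using disk_algebra_factor by blast
    let ?A = "cyc_unit n i j ?one" and ?B = "cyc_unit n j i g"
    have AB: "?A \<in> cyc_alg n" "?B \<in> cyc_alg n"
      using one g cyc_unit_in_cyc_alg by blast+
    have phi_AB: "phi n i ?A = 0" "phi n i ?B = 0"
      using assms j one g by (simp_all add: phi_cyc_unit)
    let ?P = "cyc_unit n i i (\<lambda>w. w * ?one w * g w)"
    have P: "(\<lambda>z. ?A z * ?B z) = ?P"
      using cyc_unit_mult_cyc_unit[OF i j] by blast
    have P_alg: "?P \<in> cyc_alg n"
    proof (rule cyc_unit_in_cyc_alg)
      have "(\<lambda>w. w * g w) \<in> disk_algebra"
        using g(1) by (auto simp: disk_algebra_def intro!: holomorphic_intros continuous_intros)
      moreover have "(\<lambda>w. w * ?one w * g w) = (\<lambda>w. w * g w)"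
        using g(1) by (auto simp: disk_algebra_def indicator_def fun_eq_iff)
      ultimately show "(\<lambda>w. w * ?one w * g w) \<in> disk_algebra"
        by simp
    qed
    let ?S = "cyc_unit n i i (\<lambda>w. f i i 0 * ?one w)"
    have S: "(\<lambda>z. f i i 0 \<cdot>\<^sub>m ?e z) = ?S"
      by (simp add: cyc_unit_smult)
    have S_alg: "?S \<in> cyc_alg n"
      using one
      by (intro cyc_unit_in_cyc_alg)
        (auto simp: disk_algebra_def intro!: holomorphic_intros continuous_intros)
    \<comment> \<open>The constant term carries the indicator so that both sides vanish off the
      closed disk and the equation holds on the whole plane.\<close>
    have "f i i w = f i i 0 * ?one w + w * ?one w * g w" for w
      using fi g(2)[of w] by (cases "w \<in> cball 0 1") (auto simp: disk_algebra_def)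
    then have "f i i = (\<lambda>w. f i i 0 * ?one w + w * ?one w * g w)"
      by blast
    then have "cyc_unit n i i (f i i) = (\<lambda>z. ?S z + ?P z)"
      unfolding cyc_unit_add by (rule arg_cong)
    then have "D (cyc_unit n i i (f i i)) = f i i 0 * D ?e + D ?P"
      using add[OF S_alg P_alg] smult[OF e, of "f i i 0"] S by simp
    \<comment> \<open>Each term of the product rule contains phi of an off-diagonal factor, which is
      0.\<close>
    moreover have "D ?P = 0"
      using mult[OF AB] P phi_AB by simp
    ultimately show ?thesis
      using De by simp
  qed
  ultimately show "D F = 0"
    by simp
qed

end
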